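(* For $n\ge3$ let $\chi_n(x)$ be the chromatic polynomial of the $n\times n$ toroidal grid graph $C_n\times C_n$, and for $k\ge0$ let $q_k(n^2)$ denote the coefficient of $x^{n^2-k}$ in $\chi_n(x)$. Then for each $k$ there are a polynomial $P_k$ and an integer $n_k$ such that $(-1)^kq_k(n^2)=P_k(n^2)$ for all $n\ge n_k$, and the sequence of polynomials $P_0,P_1,P_2,\dots$ is of binomial type.
   Context: $C_n$ is the cycle graph on $n$ vertices. The product graph $G_1\times G_2$ has as vertices the pairs $(v_1,v_2)$ with $v_i\in G_i$, with $(v_1,v_2)$ and $(v_1',v_2')$ adjacent iff either $v_1=v_1'$ and $v_2,v_2'$ are adjacent in $G_2$, or $v_2=v_2'$ and $v_1,v_1'$ are adjacent in $G_1$. A sequence of polynomials $P_0,P_1,P_2,\dots$ is of binomial type if $P_0=1$, $P_i(0)=0$ for $i>0$, and $\left(\sum_{i\ge0}P_i(1)x^i\right)^m=\sum_{i\ge0}P_i(m)x^i$ for all nonnegative integers $m$; the third condition may equivalently be replaced by $P_k(x+y)=\sum_{i=0}^kP_i(x)P_{k-i}(y)$ for all $k\ge 0$ (no binomial coefficients in this convention). *)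

theory Defs
  imports
    "HOL-Computational_Algebra.Computational_Algebra"
    "HOL-Library.FuncSet"
    "Graph_Theory.Pair_Digraph"
begin

text \<open>
  A finite simple graph is a \<^locale>\<open>pair_graph\<close>: a finite, loop-free, symmetric digraph without
  parallel arcs. An undirected edge between u and v is the pair of arcs (u,v) and (v,u).
\<close>

subsection \<open>Cycle graphs and product graphs\<close>

text \<open>A simple cycle only for \<open>n \<ge> 3\<close>.\<close>

definition cycle_graph :: "nat \<Rightarrow> nat pair_pre_digraph" where
  "cycle_graph n = \<lparr> pverts = {..<n},
     parcs = {(i, j). i < n \<and> j < n \<and> (j = (i + 1) mod n \<or> i = (j + 1) mod n)} \<rparr>"

definition product_graph ::
    "'a pair_pre_digraph \<Rightarrow> 'b pair_pre_digraph \<Rightarrow> ('a \<times> 'b) pair_pre_digraph" where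
  "product_graph G H = \<lparr> pverts = pverts G \<times> pverts H,
     parcs = {((u, v), (u', v')).
       (u \<in> pverts G \<and> u = u' \<and> (v, v') \<in> parcs H) \<or>
       (v \<in> pverts H \<and> v = v' \<and> (u, u') \<in> parcs G)} \<rparr>"

definition toroidal_grid :: "nat \<Rightarrow> (nat \<times> nat) pair_pre_digraph" where
  "toroidal_grid n = product_graph (cycle_graph n) (cycle_graph n)"

lemma pair_graph_cycle_graph:
  assumes "n \<ge> 3"
  shows "pair_graph (cycle_graph n)"
proof unfold_locales
  have "finite ({..<n} \<times> {..<n})" by simp
  then show "finite (parcs (cycle_graph n))"
    by (rule rev_finite_subset) (auto simp: cycle_graph_def)
  show "symmetric (with_proj (cycle_graph n))"
    by (auto simp: symmetric_def sym_def cycle_graph_def)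
  show "fst e \<noteq> snd e" if "e \<in> parcs (cycle_graph n)" for e
    using that assms by (auto simp: cycle_graph_def mod_Suc split: if_splits)
qed (auto simp: cycle_graph_def)

lemma pair_graph_product_graph:
  assumes "pair_graph G" "pair_graph H"
  shows "pair_graph (product_graph G H)"
proof -
  interpret G: pair_graph G by fact
  interpret H: pair_graph H by fact
  have sG: "sym (parcs G)" and sH: "sym (parcs H)"
    using G.sym_arcs H.sym_arcs by (auto simp: symmetric_def)
  show ?thesis
  proof unfold_locales
    have "finite ((pverts G \<times> pverts H) \<times> (pverts G \<times> pverts H))"
      using G.pair_finite_verts H.pair_finite_verts by simp
    then show "finite (parcs (product_graph G H))"
      by (rule rev_finite_subset)
        (auto simp: product_graph_def dest: G.wellformed' H.wellformed')
    show "symmetric (with_proj (product_graph G H))"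
      using sG sH by (auto simp: symmetric_def sym_def product_graph_def)
    show "finite (pverts (product_graph G H))"
      using G.pair_finite_verts H.pair_finite_verts by (simp add: product_graph_def)
    show "fst e \<noteq> snd e" if "e \<in> parcs (product_graph G H)" for e
      using that G.pair_no_loops H.pair_no_loops by (fastforce simp: product_graph_def)
  qed (auto simp: product_graph_def dest: G.wellformed' H.wellformed')
qed

lemma pair_graph_toroidal_grid: "n \<ge> 3 \<Longrightarrow> pair_graph (toroidal_grid n)"
  by (simp add: toroidal_grid_def pair_graph_product_graph pair_graph_cycle_graph)

subsection \<open>The chromatic polynomial\<close>

definition proper_colorings :: "'a pair_pre_digraph \<Rightarrow> nat \<Rightarrow> ('a \<Rightarrow> nat) set" where
  "proper_colorings G m = {f \<in> pverts G \<rightarrow>\<^sub>E {..<m}. \<forall>(u, v) \<in> parcs G. f u \<noteq> f v}"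

text \<open>Existence and uniqueness are established in \<open>poly_chromatic_poly\<close> and
  \<open>chromatic_poly_unique\<close> below.\<close>

definition chromatic_poly :: "'a pair_pre_digraph \<Rightarrow> int poly" where
  "chromatic_poly G = (THE p. \<forall>m::nat. poly p (int m) = int (card (proper_colorings G m)))"

text \<open>Deletion and contraction of a constraint \<open>(a, b)\<close>.\<close>

lemma exists_coloring_poly:
  fixes V :: "'a set" and R :: "'a rel"
  assumes "finite V" "finite R" "R \<subseteq> V \<times> V"
  shows "\<exists>p :: int poly. \<forall>m::nat.
    poly p (int m) = int (card {f \<in> V \<rightarrow>\<^sub>E {..<m}. \<forall>(u, v) \<in> R. f u \<noteq> f v})"
  using assms
proof (induction "card R" arbitrary: V R rule: less_induct)
  case less
  let ?C = "\<lambda>V R m. {f \<in> V \<rightarrow>\<^sub>E {..<m::nat}. \<forall>(u, v) \<in> (R :: 'a rel). f u \<noteq> f v}"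
  show ?case
  proof (cases "R = {}")
    case True
    have "poly (monom 1 (card V)) (int m) = int (card (?C V R m))" for m
      using less.prems True by (simp add: poly_monom card_funcsetE)
    then show ?thesis by blast
  next
    case False
    then obtain a b where ab: "(a, b) \<in> R" by auto
    define R' where "R' = R - {(a, b)}"
    define g where "g = (\<lambda>x. if x = b then a else x)"
    have R: "R = insert (a, b) R'" using ab by (auto simp: R'_def)
    have lt: "card R' < card R" unfolding R'_def by (rule card_Diff1_less[OF less.prems(2) ab])
    have abV: "a \<in> V" "b \<in> V" using ab less.prems by auto
    show ?thesis
    proof (cases "a = b")
      case True
      have "?C V R m = {}" for m using ab True by auto
      then have "poly 0 (int m) = int (card (?C V R m))" for m
        by (simp only: card.empty poly_0 of_nat_0)
      then show ?thesis by blast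
    next
      case neq: False
      define S where "S = map_prod g g ` R'"
      have fR': "finite R'" "R' \<subseteq> V \<times> V" using less.prems by (auto simp: R'_def)
      obtain p where p: "poly p (int m) = int (card (?C V R' m))" for m
        using less.hyps[OF lt less.prems(1) fR'] by blast
      have gV: "g x \<in> V - {b}" if "x \<in> V" for x
        using that abV neq by (auto simp: g_def)
      have "card S < card R" using lt card_image_le[OF fR'(1), of "map_prod g g"]
        by (simp add: S_def)
      moreover have "S \<subseteq> (V - {b}) \<times> (V - {b})"
        using fR'(2) gV unfolding S_def by fastforce
      ultimately obtain q where q: "poly q (int m) = int (card (?C (V - {b}) S m))" for m
        using less.hyps[of S "V - {b}"] less.prems fR' by (auto simp: S_def)
      have "poly (p - q) (int m) = int (card (?C V R m))" for m
      proof -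
        let ?E = "{f \<in> ?C V R' m. f a = f b}"
        have "finite (V \<rightarrow>\<^sub>E {..<m})" using less.prems by (simp add: finite_PiE)
        then have fin: "finite (?C V R' m)" by simp
        have "?C V R' m = ?C V R m \<union> ?E" "?C V R m \<inter> ?E = {}" by (auto simp: R)
        with fin have 1: "card (?C V R' m) = card (?C V R m) + card ?E"
          by (metis (no_types, lifting) card_Un_disjoint finite_Un)
        have "bij_betw (\<lambda>f. restrict f (V - {b})) ?E (?C (V - {b}) S m)"
        proof (rule bij_betw_byWitness[where f' = "\<lambda>h. restrict (h \<circ> g) V"])
          show "\<forall>f\<in>?E. restrict (restrict f (V - {b}) \<circ> g) V = f"
            using abV neq by (auto simp: g_def fun_eq_iff PiE_def extensional_def)
          show "\<forall>h\<in>?C (V - {b}) S m. restrict (restrict (h \<circ> g) V) (V - {b}) = h"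
            by (auto simp: g_def fun_eq_iff PiE_def extensional_def)
          show "(\<lambda>f. restrict f (V - {b})) ` ?E \<subseteq> ?C (V - {b}) S m"
          proof (intro image_subsetI)
            fix f assume f: "f \<in> ?E"
            have *: "restrict f (V - {b}) (g x) = f x" if "x \<in> V" for x
              using f that abV neq by (auto simp: g_def)
            have "restrict f (V - {b}) u' \<noteq> restrict f (V - {b}) v'" if S: "(u', v') \<in> S" for u' v'
            proof -
              obtain u v where uv: "(u, v) \<in> R'" "u' = g u" "v' = g v"
                using S by (auto simp: S_def)
              then have "u \<in> V" "v \<in> V" "f u \<noteq> f v" using f fR' by auto
              with uv(2,3) show ?thesis using * by metis
            qed
            moreover have "restrict f (V - {b}) \<in> (V - {b}) \<rightarrow>\<^sub>E {..<m}" using f by auto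
            ultimately show "restrict f (V - {b}) \<in> ?C (V - {b}) S m" by blast
          qed
          show "(\<lambda>h. restrict (h \<circ> g) V) ` ?C (V - {b}) S m \<subseteq> ?E"
          proof (intro image_subsetI)
            fix h assume h: "h \<in> ?C (V - {b}) S m"
            have "restrict (h \<circ> g) V \<in> V \<rightarrow>\<^sub>E {..<m}"
              using h abV neq by (auto simp: g_def PiE_iff)
            moreover have "restrict (h \<circ> g) V u \<noteq> restrict (h \<circ> g) V v" if "(u, v) \<in> R'" for u v
            proof -
              have "(g u, g v) \<in> S" using that by (force simp: S_def)
              then have "h (g u) \<noteq> h (g v)" using h by auto
              moreover have "u \<in> V" "v \<in> V" using that fR' by auto
              ultimately show ?thesis by simp
            qed
            moreover have "restrict (h \<circ> g) V a = restrict (h \<circ> g) V b"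
              using abV neq by (simp add: g_def)
            ultimately show "restrict (h \<circ> g) V \<in> ?E" by blast
          qed
        qed
        then have "card ?E = card (?C (V - {b}) S m)" by (rule bij_betw_same_card)
        with 1 show ?thesis by (simp only: p q poly_diff of_nat_add)
      qed
      then show ?thesis by blast
    qed
  qed
qed

lemma poly_eq_if_eq_on_nats:
  fixes p q :: "int poly"
  assumes "\<And>m::nat. poly p (int m) = poly q (int m)"
  shows "p = q"
proof (rule ccontr)
  assume "p \<noteq> q"
  then have "finite {x. poly (p - q) x = 0}" by (intro poly_roots_finite) simp
  then have "finite (range int)"
    by (rule rev_finite_subset) (use assms in auto)
  then show False by (simp add: finite_image_iff)
qed

lemma poly_chromatic_poly:
  assumes "pair_fin_digraph G"
  shows "poly (chromatic_poly G) (int m) = int (card (proper_colorings G m))"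
proof -
  interpret pair_fin_digraph G by fact
  have "parcs G \<subseteq> pverts G \<times> pverts G" by (auto dest: wellformed')
  then have "\<exists>p :: int poly. \<forall>m. poly p (int m) = int (card (proper_colorings G m))"
    unfolding proper_colorings_def
    using exists_coloring_poly[OF pair_finite_verts pair_finite_arcs] by blast
  then have "\<exists>!p :: int poly. \<forall>m. poly p (int m) = int (card (proper_colorings G m))"
    by (auto intro: poly_eq_if_eq_on_nats)
  from theI'[OF this] show ?thesis unfolding chromatic_poly_def by blast
qed

lemma chromatic_poly_unique:
  assumes "\<And>m::nat. poly p (int m) = int (card (proper_colorings G m))"
  shows "chromatic_poly G = p"
  unfolding chromatic_poly_def
  by (rule the_equality) (use assms in \<open>auto intro: poly_eq_if_eq_on_nats\<close>)

text \<open>The coefficient of \<open>x ^ (n\<^sup>2 - k)\<close>, written \<open>q\<^sub>k(n\<^sup>2)\<close> in the literature; it is indexed here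
  by \<open>n\<close> instead of \<open>n\<^sup>2\<close>. The case distinction guards against truncated subtraction.\<close>

definition toroidal_coeff :: "nat \<Rightarrow> nat \<Rightarrow> int" where
  "toroidal_coeff k n =
     (if k \<le> n\<^sup>2 then coeff (chromatic_poly (toroidal_grid n)) (n\<^sup>2 - k) else 0)"

subsection \<open>Sequences of polynomials of binomial type\<close>

text \<open>The convention without binomial coefficients: the third condition amounts to
  \<open>P\<^sub>k(x + y) = (\<Sum>i\<le>k. P\<^sub>i(x) P\<^sub>k\<^sub>-\<^sub>i(y))\<close>.\<close>

definition binomial_type :: "(nat \<Rightarrow> 'a::comm_ring_1 poly) \<Rightarrow> bool" where
  "binomial_type P \<longleftrightarrow>
     P 0 = 1 \<and>
     (\<forall>i>0. poly (P i) 0 = 0) \<and>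
     (\<forall>m::nat. Abs_fps (\<lambda>i. poly (P i) 1) ^ m = Abs_fps (\<lambda>i. poly (P i) (of_nat m)))"

end

theory Submission
  imports Defs
begin

text \<open>
  The proof is a cluster expansion. For a vertex set \<open>W\<close> of a graph let \<open>F\<^sub>W(t)\<close> be the power series whose
  coefficient at \<open>t ^ k\<close> is \<open>(-1) ^ k\<close> times the coefficient of \<open>x ^ (card W - k)\<close> in the chromatic
  polynomial of the subgraph induced on \<open>W\<close>. Sequences of binomial type are precisely the coefficient
  sequences of \<open>exp (x * g(t))\<close> with \<open>g(0) = 0\<close>, so the theorem says that the logarithm of \<open>F\<close> for the
  torus is \<open>n\<^sup>2 * g(t)\<close>, with each coefficient correct for large \<open>n\<close>. In place of the logarithm itself
  its derivative \<open>L = F' / F\<close> is used, which needs only multiplication and division of power series.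

  A fixed coefficient of \<open>L\<close> is a function of the vertex set \<open>W\<close>. By Moebius inversion it is a
  sum of contributions \<open>cluster R k U\<close> of the subsets \<open>U\<close> of \<open>W\<close>. Two facts make these contributions local.

  \<^item> They vanish if \<open>U\<close> has more than \<open>2 * Suc k\<close> elements (\<open>cluster_large\<close>). The same is shown first for
    the coefficients of the chromatic polynomial, in \<open>mobius_degree_le_top_coeff\<close>: the contribution
    of \<open>U\<close> there is governed by those maps on \<open>U\<close> that use no color exactly once, and they are too few to
    reach the top coefficients. The bound passes to \<open>L\<close> because degrees of set functions are
    additive under multiplication.

  \<^item> They vanish if \<open>U\<close> is disconnected (\<open>cluster_separated\<close>), because the chromatic polynomial is
    multiplicative and therefore \<open>L\<close> is additive over disjoint unions without edges between the parts.

  Hence only small connected sets contribute. Distributing each contribution equally over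
  the vertices of \<open>U\<close> writes the coefficient as a sum over the vertices, and the share of a vertex depends
  only on a ball of bounded radius around it (\<open>cluster_local\<close>). If \<open>n\<close> is large compared with
  \<open>k\<close>, each such ball in the torus is isomorphic to the ball around the origin of the infinite grid
  \<open>\<int> \<times> \<int>\<close>. All \<open>n\<^sup>2\<close> vertices therefore have the same share, which does not depend on \<open>n\<close>
  (\<open>chi_logderiv_torus\<close>).
\<close>

section \<open>Moebius transforms of set functions\<close>

text \<open>The unique set function whose sums over the subsets of \<open>S\<close> give \<open>f S\<close> for every finite \<open>S\<close>.\<close>

definition mobius :: "('a set \<Rightarrow> real) \<Rightarrow> 'a set \<Rightarrow> real" where
  "mobius f U = (\<Sum>T\<in>Pow U. (-1) ^ (card U - card T) * f T)"

lemma sum_mobius: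
  assumes "finite S"
  shows "(\<Sum>T\<in>Pow S. mobius f T) = f S"
proof -
  define g where "g S = (\<Sum>T\<in>Pow S. (-1) ^ card T * f T)" for S
  have "mobius f T = (-1) ^ card T * g T" if "finite T" for T
  proof -
    have "(-1 :: real) ^ (card T - card X) = (-1) ^ card T * (-1) ^ card X" if "X \<in> Pow T" for X
      using card_mono[OF \<open>finite T\<close>, of X] that
      by (auto simp: minus_one_power_iff)
    then show ?thesis
      unfolding mobius_def g_def sum_distrib_left by (intro sum.cong) auto
  qed
  then have "(\<Sum>T\<in>Pow S. mobius f T) = (\<Sum>T\<in>Pow S. (-1) ^ card T * g T)"
    using assms by (intro sum.cong) (auto intro: finite_subset)
  also have "\<dots> = f S"
    by (rule inclusion_exclusion_symmetric[symmetric, OF _ assms]) (simp add: g_def)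
  finally show ?thesis .
qed

lemma mobius_eqI:
  assumes "\<And>S. finite S \<Longrightarrow> f S = sum a (Pow S)" "finite U"
  shows "mobius f U = a U"
  unfolding mobius_def using inclusion_exclusion_mobius[of f a, OF assms] by simp

lemma mobius_cong:
  "(\<And>T. T \<subseteq> U \<Longrightarrow> f T = g T) \<Longrightarrow> mobius f U = mobius g U"
  by (auto simp: mobius_def intro!: sum.cong)

lemma mobius_add: "mobius (\<lambda>S. f S + g S) U = mobius f U + mobius g U"
  by (simp add: mobius_def algebra_simps sum.distrib)

lemma mobius_cmult: "mobius (\<lambda>S. c * f S) U = c * mobius f U"
  by (simp add: mobius_def sum_distrib_left mult_ac)

lemma mobius_minus: "mobius (\<lambda>S. f S - g S) U = mobius f U - mobius g U"
  by (simp add: mobius_def algebra_simps sum_subtractf)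

lemma mobius_sum: "mobius (\<lambda>S. \<Sum>i\<in>I. f i S) U = (\<Sum>i\<in>I. mobius (f i) U)"
  unfolding mobius_def sum_distrib_left by (rule sum.swap)

lemma mobius_image:
  assumes "inj_on g U"
  shows "mobius f (g ` U) = mobius (\<lambda>T. f (g ` T)) U"
proof -
  have "mobius f (g ` U) = (\<Sum>T\<in>Pow U. (-1) ^ (card (g ` U) - card (g ` T)) * f (g ` T))"
    unfolding mobius_def image_Pow_surj[OF refl, symmetric]
    by (rule sum.reindex_cong[OF inj_on_image_Pow[OF assms] refl refl])
  also have "\<dots> = mobius (\<lambda>T. f (g ` T)) U"
    unfolding mobius_def
    by (intro sum.cong refl) (use assms in \<open>auto simp: card_image inj_on_subset\<close>)
  finally show ?thesis .
qed

text \<open>If \<open>f\<close> does not notice the point \<open>v\<close>, the terms of \<open>T\<close> and \<open>insert v T\<close> cancel. This one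
  cancellation gives both the degree bound on the coefficients of chromatic polynomials and the
  vanishing of clusters on disconnected sets.\<close>

lemma mobius_eq_0I:
  assumes "finite U" "v \<in> U" "\<And>T. T \<subseteq> U - {v} \<Longrightarrow> f (insert v T) = f T"
  shows "mobius f U = 0"
proof -
  let ?U = "U - {v}"
  have fin: "finite ?U" using assms by simp
  have Pow: "Pow U = Pow ?U \<union> insert v ` Pow ?U"
    using Pow_insert[of v ?U] assms(2) by (simp add: insert_absorb)
  have inj: "inj_on (insert v) (Pow ?U)" by (auto simp: inj_on_def)
  have "mobius f U = (\<Sum>T\<in>Pow ?U. (-1) ^ (card U - card T) * f T)
      + (\<Sum>T\<in>insert v ` Pow ?U. (-1) ^ (card U - card T) * f T)"
    unfolding mobius_def Pow using fin by (intro sum.union_disjoint) auto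
  also have "(\<Sum>T\<in>insert v ` Pow ?U. (-1) ^ (card U - card T) * f T)
      = (\<Sum>T\<in>Pow ?U. (-1) ^ (card U - card (insert v T)) * f (insert v T))"
    by (simp add: sum.reindex[OF inj])
  also have "\<dots> = (\<Sum>T\<in>Pow ?U. - ((-1) ^ (card U - card T) * f T))"
  proof (rule sum.cong[OF refl])
    fix T assume T: "T \<in> Pow ?U"
    then have "finite T" "v \<notin> T" using fin by (auto intro: finite_subset)
    moreover have "card T < card U"
      using T assms by (intro psubset_card_mono) auto
    ultimately have "card U - card T = Suc (card U - card (insert v T))" by simp
    then show "(-1) ^ (card U - card (insert v T)) * f (insert v T)
        = - ((-1) ^ (card U - card T) * f T)"
      using assms(3)[of T] T by simp
  qed
  finally show ?thesis by (simp add: sum_negf)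
qed

lemma abs_mobius_le:
  assumes "finite U" "\<And>T. T \<subseteq> U \<Longrightarrow> \<bar>f T\<bar> \<le> c"
  shows "\<bar>mobius f U\<bar> \<le> 2 ^ card U * c"
proof -
  have "\<bar>mobius f U\<bar> \<le> (\<Sum>T\<in>Pow U. \<bar>(-1) ^ (card U - card T) * f T\<bar>)"
    unfolding mobius_def by (rule sum_abs)
  also have "\<dots> \<le> (\<Sum>T\<in>Pow U. c)"
    by (rule sum_mono) (auto simp: abs_mult power_abs assms)
  finally show ?thesis using assms by (simp add: card_Pow)
qed

text \<open>A set function has degree at most \<open>d\<close> if it is a polynomial of that degree in the indicator
  variables of the points: its value at \<open>S\<close> is a sum of local contributions of the subsets of \<open>S\<close>
  with at most \<open>d\<close> elements. Degrees add up under multiplication, as they do for polynomials.\<close>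

definition mobius_degree_le :: "nat \<Rightarrow> ('a set \<Rightarrow> real) \<Rightarrow> bool" where
  "mobius_degree_le d f \<longleftrightarrow> (\<forall>U. finite U \<longrightarrow> d < card U \<longrightarrow> mobius f U = 0)"

lemma mobius_degree_le_mono: "mobius_degree_le d f \<Longrightarrow> d \<le> e \<Longrightarrow> mobius_degree_le e f"
  by (auto simp: mobius_degree_le_def)

lemma mobius_degree_le_cmult: "mobius_degree_le d f \<Longrightarrow> mobius_degree_le d (\<lambda>S. c * f S)"
  by (simp add: mobius_degree_le_def mobius_cmult)

lemma mobius_degree_le_minus:
  "mobius_degree_le d f \<Longrightarrow> mobius_degree_le d g \<Longrightarrow> mobius_degree_le d (\<lambda>S. f S - g S)"
  by (simp add: mobius_degree_le_def mobius_minus)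

lemma mobius_degree_le_sum:
  "(\<And>i. i \<in> I \<Longrightarrow> mobius_degree_le d (f i)) \<Longrightarrow> mobius_degree_le d (\<lambda>S. \<Sum>i\<in>I. f i S)"
  by (simp add: mobius_degree_le_def mobius_sum)

text \<open>Expanding both factors into contributions of \<open>A\<close> and \<open>B\<close>, the product collects those pairs in
  the contribution of \<open>A \<union> B\<close>.\<close>

lemma mobius_mult:
  assumes "finite U"
  shows "mobius (\<lambda>S. f S * g S) U =
    (\<Sum>(A, B) \<in> {(A, B). A \<in> Pow U \<and> B \<in> Pow U \<and> A \<union> B = U}. mobius f A * mobius g B)"
proof (rule mobius_eqI[OF _ assms])
  fix S :: "'a set" assume S: "finite S"
  let ?D = "\<lambda>U. {(A, B). A \<in> Pow U \<and> B \<in> Pow U \<and> A \<union> B = U}"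
  have "f S * g S = (\<Sum>A\<in>Pow S. mobius f A) * (\<Sum>B\<in>Pow S. mobius g B)"
    using S by (simp add: sum_mobius)
  also have "\<dots> = (\<Sum>(A, B)\<in>Pow S \<times> Pow S. mobius f A * mobius g B)"
    by (simp add: sum_product sum.cartesian_product)
  also have "\<dots> = (\<Sum>U\<in>Pow S. \<Sum>(A, B)\<in>{x \<in> Pow S \<times> Pow S. fst x \<union> snd x = U}.
      mobius f A * mobius g B)"
    using S by (intro sum.group[symmetric]) auto
  also have "\<dots> = (\<Sum>U\<in>Pow S. \<Sum>(A, B)\<in>?D U. mobius f A * mobius g B)"
    by (intro sum.cong refl) auto
  finally show "f S * g S = (\<Sum>U\<in>Pow S. \<Sum>(A, B)\<in>?D U. mobius f A * mobius g B)" .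
qed

lemma mobius_degree_le_mult:
  assumes "mobius_degree_le d f" "mobius_degree_le e g"
  shows "mobius_degree_le (d + e) (\<lambda>S. f S * g S)"
  unfolding mobius_degree_le_def
proof (intro allI impI)
  fix U :: "'a set" assume U: "finite U" "d + e < card U"
  have "mobius f A * mobius g B = 0" if "A \<subseteq> U" "B \<subseteq> U" "A \<union> B = U" for A B
  proof -
    have fin: "finite A" "finite B" using that U finite_subset by auto
    have "card U \<le> card A + card B" using card_Un_le[of A B] that by simp
    then have "d < card A \<or> e < card B" using U by linarith
    then show ?thesis using assms fin by (auto simp: mobius_degree_le_def)
  qed
  then show "mobius (\<lambda>S. f S * g S) U = 0"
    unfolding mobius_mult[OF U(1)] by (intro sum.neutral) auto
qed

section \<open>Counting colorings\<close>

lemma card_PiE_Un_restrict: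
  assumes "A \<inter> B = {}"
  shows "card {f \<in> A \<union> B \<rightarrow>\<^sub>E M. P (restrict f A) \<and> Q (restrict f B)}
    = card {f \<in> A \<rightarrow>\<^sub>E M. P f} * card {f \<in> B \<rightarrow>\<^sub>E M. Q f}"
proof -
  let ?glue = "\<lambda>(g, h). \<lambda>x. if x \<in> A then g x else if x \<in> B then h x else undefined"
  have 1: "restrict (?glue (g, h)) A = g" if "g \<in> A \<rightarrow>\<^sub>E M" for g h
    using that by (auto simp: fun_eq_iff PiE_def extensional_def)
  have 2: "restrict (?glue (g, h)) B = h" if "h \<in> B \<rightarrow>\<^sub>E M" for g h
    using that assms by (auto simp: fun_eq_iff PiE_def extensional_def)
  have "bij_betw (\<lambda>f. (restrict f A, restrict f B))
      {f \<in> A \<union> B \<rightarrow>\<^sub>E M. P (restrict f A) \<and> Q (restrict f B)}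
      ({f \<in> A \<rightarrow>\<^sub>E M. P f} \<times> {f \<in> B \<rightarrow>\<^sub>E M. Q f})"
  proof (rule bij_betw_byWitness[where f' = ?glue])
    show "\<forall>f\<in>{f \<in> A \<union> B \<rightarrow>\<^sub>E M. P (restrict f A) \<and> Q (restrict f B)}.
        ?glue (restrict f A, restrict f B) = f"
      by (auto simp: fun_eq_iff PiE_def extensional_def)
    show "\<forall>x\<in>{f \<in> A \<rightarrow>\<^sub>E M. P f} \<times> {f \<in> B \<rightarrow>\<^sub>E M. Q f}.
        (restrict (?glue x) A, restrict (?glue x) B) = x"
      using 1 2 by auto
    show "(\<lambda>f. (restrict f A, restrict f B)) `
        {f \<in> A \<union> B \<rightarrow>\<^sub>E M. P (restrict f A) \<and> Q (restrict f B)}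
        \<subseteq> {f \<in> A \<rightarrow>\<^sub>E M. P f} \<times> {f \<in> B \<rightarrow>\<^sub>E M. Q f}"
      by auto
    show "?glue ` ({f \<in> A \<rightarrow>\<^sub>E M. P f} \<times> {f \<in> B \<rightarrow>\<^sub>E M. Q f})
        \<subseteq> {f \<in> A \<union> B \<rightarrow>\<^sub>E M. P (restrict f A) \<and> Q (restrict f B)}"
    proof (rule image_subsetI)
      fix x assume x: "x \<in> {f \<in> A \<rightarrow>\<^sub>E M. P f} \<times> {f \<in> B \<rightarrow>\<^sub>E M. Q f}"
      then have "?glue x \<in> A \<union> B \<rightarrow>\<^sub>E M"
        by (auto simp: PiE_iff extensional_def)
      moreover have "restrict (?glue x) A = fst x" "restrict (?glue x) B = snd x"
        using x 1 2 by auto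
      ultimately show "?glue x
          \<in> {f \<in> A \<union> B \<rightarrow>\<^sub>E M. P (restrict f A) \<and> Q (restrict f B)}"
        using x by auto
    qed
  qed
  from bij_betw_same_card[OF this] show ?thesis by (simp add: card_cartesian_product)
qed

text \<open>Each color that occurs is used at least twice.\<close>

lemma card_image_le_half:
  assumes "finite U" "\<And>v. v \<in> U \<Longrightarrow> \<exists>u\<in>U. u \<noteq> v \<and> f u = f v"
  shows "card (f ` U) \<le> card U div 2"
proof -
  have "2 \<le> card {x \<in> U. f x = y}" if "y \<in> f ` U" for y
  proof -
    obtain v where v: "v \<in> U" "f v = y" using \<open>y \<in> f ` U\<close> by auto
    then obtain u where "u \<in> U" "u \<noteq> v" "f u = y" using assms(2)[of v] by auto
    with v have "{u, v} \<subseteq> {x \<in> U. f x = y}" by auto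
    from card_mono[OF _ this] show ?thesis using \<open>u \<noteq> v\<close> assms(1) by simp
  qed
  then have "(\<Sum>y\<in>f ` U. 2) \<le> (\<Sum>y\<in>f ` U. card {x \<in> U. f x = y})" by (rule sum_mono)
  also have "\<dots> = card U"
    using sum.image_gen[OF assms(1), of "\<lambda>_. 1 :: nat" f] by simp
  finally show ?thesis by simp
qed

lemma card_small_image_le:
  assumes "finite U" "h \<le> m"
  shows "card {f \<in> U \<rightarrow>\<^sub>E {..<m}. card (f ` U) \<le> h} \<le> m ^ h * h ^ card U"
proof -
  let ?A = "{A. A \<subseteq> {..<m} \<and> card A = h}"
  have finA: "finite ?A" by (rule finite_subset[of _ "Pow {..<m}"]) auto
  have fin: "finite A" if "A \<in> ?A" for A using that finite_subset by auto
  have sub: "{f \<in> U \<rightarrow>\<^sub>E {..<m}. card (f ` U) \<le> h} \<subseteq> (\<Union>A\<in>?A. U \<rightarrow>\<^sub>E A)"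
  proof
    fix f assume f: "f \<in> {f \<in> U \<rightarrow>\<^sub>E {..<m}. card (f ` U) \<le> h}"
    then have "f ` U \<subseteq> {..<m}" by auto
    then obtain A where "f ` U \<subseteq> A" "A \<subseteq> {..<m}" "card A = h"
      using exists_subset_between[of "f ` U" h "{..<m}"] f assms(2) by auto
    with f show "f \<in> (\<Union>A\<in>?A. U \<rightarrow>\<^sub>E A)" by (auto simp: PiE_iff)
  qed
  have "card {f \<in> U \<rightarrow>\<^sub>E {..<m}. card (f ` U) \<le> h} \<le> card (\<Union>A\<in>?A. U \<rightarrow>\<^sub>E A)"
  proof (rule card_mono[OF _ sub])
    have "finite (U \<rightarrow>\<^sub>E A)" if "A \<in> ?A" for A
      using fin[OF that] assms(1) by (intro finite_PiE) auto
    then show "finite (\<Union>A\<in>?A. U \<rightarrow>\<^sub>E A)" using finA by blast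
  qed
  also have "\<dots> \<le> (\<Sum>A\<in>?A. card (U \<rightarrow>\<^sub>E A))" by (rule card_UN_le[OF finA])
  also have "\<dots> = (m choose h) * h ^ card U"
    using assms(1) n_subsets[of "{..<m}" h] by (simp add: card_funcsetE)
  also have "\<dots> \<le> m ^ h * h ^ card U" using binomial_le_pow[OF assms(2)] by simp
  finally show ?thesis .
qed

text \<open>Bounds on the degree of a polynomial that counts something come from bounding the count.\<close>

lemma degree_le_if_growth:
  fixes p :: "real poly"
  assumes "\<And>m::nat. m \<ge> m0 \<Longrightarrow> \<bar>poly p (real m)\<bar> \<le> c * real m ^ h"
  shows "degree p \<le> h"
proof (rule ccontr)
  assume deg: "\<not> degree p \<le> h"
  have False if q: "lead_coeff q > 0" "degree q = degree p"
    "\<And>m::nat. m \<ge> m0 \<Longrightarrow> poly q (real m) \<le> c * real m ^ h" for q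
  proof -
    let ?r = "q - monom c h"
    have "degree (monom c h) < degree q"
      using degree_monom_le[of c h] deg q(2) by linarith
    then have "degree ?r = degree q" by (metis degree_add_eq_left degree_minus diff_conv_add_uminus)
    moreover have "coeff (monom c h) (degree q) = 0" using deg q(2) by auto
    ultimately have "lead_coeff ?r > 0" using q(1) by simp
    then obtain x0 where x0: "\<And>x. x \<ge> x0 \<Longrightarrow> poly ?r x \<ge> lead_coeff ?r"
      using poly_pinfty_gt_lc by blast
    obtain m where m: "m \<ge> m0" "real m \<ge> x0"
      by (metis max.bounded_iff max_def nat_le_linear of_nat_mono order.trans real_arch_simple)
    show False
      using x0[OF m(2)] \<open>lead_coeff ?r > 0\<close> q(3)[OF m(1)] by (simp add: poly_monom)
  qed
  note contr = this
  have "lead_coeff p \<noteq> 0" using deg by auto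
  then consider "lead_coeff p > 0" | "lead_coeff (- p) > 0"
    using linorder_neqE_linordered_idom by (fastforce simp del: leading_coeff_0_iff)
  then show False
  proof cases
    case 1
    then show False by (rule contr) (use assms in \<open>force simp: abs_le_iff\<close>)+
  next
    case 2
    then show False by (rule contr) (use assms in \<open>force simp: abs_le_iff\<close>)+
  qed
qed

lemma real_poly_eq_if_eq_on_nats:
  fixes p q :: "real poly"
  assumes "\<And>m::nat. poly p (real m) = poly q (real m)"
  shows "p = q"
proof (rule ccontr)
  assume "p \<noteq> q"
  then have "finite {x. poly (p - q) x = 0}" by (intro poly_roots_finite) simp
  then have "finite (range real)"
    by (rule rev_finite_subset) (use assms in auto)
  then show False by (simp add: finite_image_iff inj_on_def)
qed

section \<open>Chromatic polynomials of induced subgraphs\<close>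

definition graph_on :: "'a rel \<Rightarrow> 'a set \<Rightarrow> 'a pair_pre_digraph" where
  "graph_on R W = \<lparr> pverts = W, parcs = R \<inter> (W \<times> W) \<rparr>"

definition proper_on :: "'a rel \<Rightarrow> 'a set \<Rightarrow> ('a \<Rightarrow> nat) \<Rightarrow> bool" where
  "proper_on R W f \<longleftrightarrow> (\<forall>u\<in>W. \<forall>v\<in>W. (u, v) \<in> R \<longrightarrow> f u \<noteq> f v)"

text \<open>Working with a relation \<open>R\<close> and all its finite vertex sets \<open>W\<close> at once makes the chromatic
  polynomial a set function, to which the Moebius transform applies. Real coefficients are needed
  because logarithms will be taken.\<close>

definition chi :: "'a rel \<Rightarrow> 'a set \<Rightarrow> real poly" where
  "chi R W = map_poly of_int (chromatic_poly (graph_on R W))"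

lemma poly_map_poly_of_int: "poly (map_poly of_int p) (of_int x :: real) = of_int (poly p x)"
  by (induction p) (auto simp: map_poly_pCons)

lemma poly_chi:
  assumes "finite W"
  shows "poly (chi R W) (real m) = real (card {f \<in> W \<rightarrow>\<^sub>E {..<m}. proper_on R W f})"
proof -
  have "pair_fin_digraph (graph_on R W)"
    by unfold_locales (use assms in \<open>auto simp: graph_on_def\<close>)
  moreover have "proper_colorings (graph_on R W) m = {f \<in> W \<rightarrow>\<^sub>E {..<m}. proper_on R W f}"
    by (auto simp: proper_colorings_def graph_on_def proper_on_def)
  ultimately show ?thesis
    using poly_map_poly_of_int[of "chromatic_poly (graph_on R W)" "int m"]
    by (simp add: chi_def poly_chromatic_poly)
qed

lemma proper_on_restrict: "W \<subseteq> V \<Longrightarrow> proper_on R W (restrict f V) = proper_on R W f"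
  by (auto simp: proper_on_def subset_iff)

definition separated :: "'a rel \<Rightarrow> 'a set \<Rightarrow> 'a set \<Rightarrow> bool" where
  "separated R A B \<longleftrightarrow> A \<inter> B = {} \<and> (\<forall>a\<in>A. \<forall>b\<in>B. (a, b) \<notin> R \<and> (b, a) \<notin> R)"

lemma chi_separated:
  assumes "finite A" "finite B" "separated R A B"
  shows "chi R (A \<union> B) = chi R A * chi R B"
proof (rule real_poly_eq_if_eq_on_nats)
  fix m
  have "{f \<in> A \<union> B \<rightarrow>\<^sub>E {..<m}. proper_on R (A \<union> B) f}
      = {f \<in> A \<union> B \<rightarrow>\<^sub>E {..<m}. proper_on R A (restrict f A) \<and> proper_on R B (restrict f B)}"
    using assms(3) unfolding proper_on_restrict[OF order_refl]
    by (auto simp: proper_on_def separated_def)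
  then show "poly (chi R (A \<union> B)) (real m) = poly (chi R A * chi R B) (real m)"
    using assms by (simp add: poly_chi card_PiE_Un_restrict separated_def)
qed

lemma chi_image:
  assumes "finite W" "inj_on g W"
    and "\<And>u v. u \<in> W \<Longrightarrow> v \<in> W \<Longrightarrow> (g u, g v) \<in> S \<longleftrightarrow> (u, v) \<in> R"
  shows "chi S (g ` W) = chi R W"
proof (rule real_poly_eq_if_eq_on_nats)
  fix m
  let ?C = "{f \<in> g ` W \<rightarrow>\<^sub>E {..<m}. proper_on S (g ` W) f}"
  let ?D = "{f \<in> W \<rightarrow>\<^sub>E {..<m}. proper_on R W f}"
  let ?i = "inv_into W g"
  have i: "?i (g x) = x" if "x \<in> W" for x using inv_into_f_f[OF assms(2) that] .
  have "bij_betw (\<lambda>f. restrict (f \<circ> g) W) ?C ?D"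
  proof (rule bij_betw_byWitness[where f' = "\<lambda>f. restrict (f \<circ> ?i) (g ` W)"])
    show "\<forall>f\<in>?C. restrict (restrict (f \<circ> g) W \<circ> ?i) (g ` W) = f"
      by (auto simp: fun_eq_iff PiE_def extensional_def i inv_into_into)
    show "\<forall>f\<in>?D. restrict (restrict (f \<circ> ?i) (g ` W) \<circ> g) W = f"
      by (auto simp: fun_eq_iff PiE_def extensional_def i)
    show "(\<lambda>f. restrict (f \<circ> g) W) ` ?C \<subseteq> ?D"
      using assms(3) by (auto simp: proper_on_def)
    show "(\<lambda>f. restrict (f \<circ> ?i) (g ` W)) ` ?D \<subseteq> ?C"
      using assms(3) by (auto simp: proper_on_def i)
  qed
  from bij_betw_same_card[OF this]
  show "poly (chi S (g ` W)) (real m) = poly (chi R W) (real m)"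
    using assms(1) by (simp add: poly_chi)
qed

text \<open>Counted from the top, the coefficients of different vertex sets become comparable: adding an
  isolated vertex multiplies the polynomial by \<open>x\<close> and leaves \<open>top_coeff\<close> unchanged.\<close>

definition top_coeff :: "'a rel \<Rightarrow> nat \<Rightarrow> 'a set \<Rightarrow> real" where
  "top_coeff R k W = (if k \<le> card W then coeff (chi R W) (card W - k) else 0)"

lemma degree_chi_le:
  assumes "finite W"
  shows "degree (chi R W) \<le> card W"
proof (rule degree_le_if_growth[of 0 _ 1])
  fix m :: nat
  have "card {f \<in> W \<rightarrow>\<^sub>E {..<m}. proper_on R W f} \<le> card (W \<rightarrow>\<^sub>E {..<m})"
    using assms by (intro card_mono finite_PiE) auto
  then show "\<bar>poly (chi R W) (real m)\<bar> \<le> 1 * real m ^ card W"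
    using assms by (simp add: poly_chi card_funcsetE flip: of_nat_power)
qed

text \<open>A vertex whose color occurs nowhere else cannot violate properness.\<close>

lemma mobius_proper_on_eq_0:
  assumes "finite U" "irrefl R" "v \<in> U" "\<And>u. u \<in> U \<Longrightarrow> u \<noteq> v \<Longrightarrow> f u \<noteq> f v"
  shows "mobius (\<lambda>W. of_bool (proper_on R W f)) U = 0"
proof (rule mobius_eq_0I[OF assms(1,3)])
  fix T assume T: "T \<subseteq> U - {v}"
  have "proper_on R (insert v T) f = proper_on R T f"
    using assms(2,4) T unfolding proper_on_def irrefl_def by (metis Diff_iff insert_iff subsetD)
  then show "of_bool (proper_on R (insert v T) f) = (of_bool (proper_on R T f) :: real)" by simp
qed

text \<open>The Moebius transform of \<open>top_coeff R k\<close> at \<open>U\<close> is the coefficient of \<open>x ^ (card U - k)\<close> in the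
  polynomial \<open>D\<close> below, in which each \<open>chi R W\<close> is multiplied by a power of \<open>x\<close> that stands for
  arbitrary colors on \<open>U - W\<close>. At \<open>x = m\<close>, this polynomial is a sum over all maps
  \<open>f\<close> from \<open>U\<close> to \<open>m\<close> colors, and \<open>f\<close> contributes \<open>0\<close> as soon as one of its colors is used only
  once. The other maps use at most half as many colors as there are vertices, hence there are only
  \<open>O(m ^ (card U div 2))\<close> of them. So \<open>D\<close> has degree at most \<open>card U div 2\<close>, and its coefficient at
  \<open>card U - k\<close> vanishes if \<open>2 * k < card U\<close>.\<close>

lemma mobius_degree_le_top_coeff:
  assumes "irrefl R"
  shows "mobius_degree_le (2 * k) (top_coeff R k)"
  unfolding mobius_degree_le_def
proof (intro allI impI)
  fix U :: "'a set" assume U: "finite U" "2 * k < card U"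
  define D where "D = (\<Sum>W\<in>Pow U. smult ((-1) ^ (card U - card W))
    (monom 1 (card U - card W) * chi R W))"
  define h where "h = card U div 2"
  have cW: "card W \<le> card U" "finite W" if "W \<subseteq> U" for W
    using card_mono[OF U(1) that] finite_subset[OF that U(1)] by auto
  have poly_D: "poly D (real m) =
      (\<Sum>f\<in>U \<rightarrow>\<^sub>E {..<m}. mobius (\<lambda>W. of_bool (proper_on R W f)) U)" for m
  proof -
    have fin: "finite (U \<rightarrow>\<^sub>E {..<m})" using U by (simp add: finite_PiE)
    have "real m ^ (card U - card W) * poly (chi R W) (real m)
        = (\<Sum>f\<in>U \<rightarrow>\<^sub>E {..<m}. of_bool (proper_on R W f))" if W: "W \<subseteq> U" for W
    proof -
      have "{f \<in> U \<rightarrow>\<^sub>E {..<m}. proper_on R W f}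
          = {f \<in> W \<union> (U - W) \<rightarrow>\<^sub>E {..<m}. proper_on R W (restrict f W) \<and> True}"
        using W by (simp add: proper_on_restrict Un_absorb1)
      then have "card {f \<in> U \<rightarrow>\<^sub>E {..<m}. proper_on R W f}
          = card {f \<in> W \<rightarrow>\<^sub>E {..<m}. proper_on R W f} * m ^ (card U - card W)"
        using card_PiE_Un_restrict[of W "U - W" "{..<m}" "proper_on R W" "\<lambda>_. True"] U W cW[OF W]
        by (simp add: card_funcsetE card_Diff_subset)
      moreover have "(\<Sum>f\<in>U \<rightarrow>\<^sub>E {..<m}. of_bool (proper_on R W f))
          = real (card {f \<in> U \<rightarrow>\<^sub>E {..<m}. proper_on R W f})"
        using fin by (simp add: sum.If_cases of_bool_def Int_def)
      ultimately show ?thesis using cW[OF W] by (simp add: poly_chi)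
    qed
    then have "poly D (real m)
        = mobius (\<lambda>W. \<Sum>f\<in>U \<rightarrow>\<^sub>E {..<m}. of_bool (proper_on R W f)) U"
      unfolding D_def mobius_def poly_sum poly_smult poly_mult poly_monom
      by (intro sum.cong) auto
    then show ?thesis by (simp only: mobius_sum)
  qed
  have "degree D \<le> h"
  proof (rule degree_le_if_growth)
    fix m assume m: "h \<le> m"
    let ?F = "{f \<in> U \<rightarrow>\<^sub>E {..<m}. card (f ` U) \<le> h}"
    have fin: "finite (U \<rightarrow>\<^sub>E {..<m})" using U by (simp add: finite_PiE)
    have "mobius (\<lambda>W. of_bool (proper_on R W f)) U = 0" if f: "f \<in> (U \<rightarrow>\<^sub>E {..<m}) - ?F" for f
    proof -
      have "\<not> card (f ` U) \<le> card U div 2" using f by (auto simp: h_def)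
      then obtain v where "v \<in> U" "\<And>u. u \<in> U \<Longrightarrow> u \<noteq> v \<Longrightarrow> f u \<noteq> f v"
        using card_image_le_half[OF U(1), of f] by blast
      then show ?thesis using mobius_proper_on_eq_0[OF U(1) assms] by blast
    qed
    then have "poly D (real m) = (\<Sum>f\<in>?F. mobius (\<lambda>W. of_bool (proper_on R W f)) U)"
      unfolding poly_D using fin by (intro sum.mono_neutral_right) auto
    also have "\<bar>\<dots>\<bar> \<le> (\<Sum>f\<in>?F. \<bar>mobius (\<lambda>W. of_bool (proper_on R W f)) U\<bar>)" by (rule sum_abs)
    also have "\<dots> \<le> (\<Sum>f\<in>?F. 2 ^ card U)"
      using abs_mobius_le[OF U(1), of _ 1] by (intro sum_mono) auto
    also have "\<dots> \<le> 2 ^ card U * real (m ^ h * h ^ card U)"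
      using card_small_image_le[OF U(1) m] by (simp flip: of_nat_power of_nat_mult)
    finally show "\<bar>poly D (real m)\<bar> \<le> (2 ^ card U * real (h ^ card U)) * real m ^ h"
      by (simp add: mult_ac)
  qed
  then have "coeff D (card U - k) = 0"
    using U(2) by (intro coeff_eq_0) (auto simp: h_def)
  also have "coeff D (card U - k) = mobius (top_coeff R k) U"
    unfolding D_def mobius_def coeff_sum coeff_smult coeff_monom_mult
  proof (intro sum.cong refl, goal_cases)
    case (1 W)
    then have "card W \<le> card U" using cW by auto
    then show ?case using U(2) by (auto simp: top_coeff_def)
  qed
  finally show "mobius (top_coeff R k) U = 0" by simp
qed

lemma chi_empty: "chi R {} = 1"
  by (rule real_poly_eq_if_eq_on_nats) (simp add: poly_chi proper_on_def)

text \<open>The case \<open>k = 0\<close> of the degree bound says that the leading coefficient is a constant set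
  function; its value can then be read off at the empty set.\<close>

lemma top_coeff_0:
  assumes "irrefl R" "finite W"
  shows "top_coeff R 0 W = 1"
proof -
  have "top_coeff R 0 W = (\<Sum>T\<in>Pow W. mobius (top_coeff R 0) T)"
    using assms by (simp add: sum_mobius)
  also have "\<dots> = (\<Sum>T\<in>{{}}. mobius (top_coeff R 0) T)"
    using mobius_degree_le_top_coeff[OF assms(1), of 0] assms(2)
    by (intro sum.mono_neutral_right)
      (auto simp: mobius_degree_le_def card_gt_0_iff intro: finite_subset)
  also have "\<dots> = 1" by (simp add: mobius_def top_coeff_def chi_empty)
  finally show ?thesis .
qed

lemma degree_chi:
  assumes "irrefl R" "finite W"
  shows "degree (chi R W) = card W"
  using top_coeff_0[OF assms] degree_chi_le[OF assms(2), of R]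
  by (intro antisym le_degree) (auto simp: top_coeff_def)

section \<open>The logarithmic derivative\<close>

text \<open>The generating function of the coefficients from the top, with signs: reversing the polynomial
  preserves products, so disjoint unions still correspond to products.\<close>

definition chi_fps :: "'a rel \<Rightarrow> 'a set \<Rightarrow> real fps" where
  "chi_fps R W = fps_of_poly (reflect_poly (chi R W)) oo (- fps_X)"

text \<open>The logarithmic derivative turns products into sums while its coefficients stay polynomials in
  the coefficients of \<open>chi_fps\<close>.\<close>

definition chi_logderiv :: "'a rel \<Rightarrow> 'a set \<Rightarrow> real fps" where
  "chi_logderiv R W = fps_deriv (chi_fps R W) / chi_fps R W"

lemma chi_fps_nth:
  assumes "irrefl R" "finite W"
  shows "chi_fps R W $ k = (-1) ^ k * top_coeff R k W"
  by (simp add: chi_fps_def fps_compose_uminus' coeff_reflect_poly degree_chi[OF assms]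
      top_coeff_def)

lemma chi_fps_nth_0:
  assumes "irrefl R" "finite W"
  shows "chi_fps R W $ 0 = 1"
  by (simp add: chi_fps_nth assms top_coeff_0)

lemma fps_deriv_chi_fps:
  assumes "irrefl R" "finite W"
  shows "fps_deriv (chi_fps R W) = chi_logderiv R W * chi_fps R W"
  using chi_fps_nth_0[OF assms]
  by (simp add: chi_logderiv_def fps_divide_unit inverse_mult_eq_1 mult.assoc)

lemma chi_logderiv_separated:
  assumes "irrefl R" "finite A" "finite B" "separated R A B"
  shows "chi_logderiv R (A \<union> B) = chi_logderiv R A + chi_logderiv R B"
proof -
  let ?F = "chi_fps R A" and ?G = "chi_fps R B"
  have 0: "?F $ 0 \<noteq> 0" "?G $ 0 \<noteq> 0" using assms by (simp_all add: chi_fps_nth_0)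
  then have ne: "?F \<noteq> 0" "?G \<noteq> 0" by auto
  have mult: "chi_fps R (A \<union> B) = ?F * ?G"
    by (simp add: chi_fps_def chi_separated assms reflect_poly_mult fps_of_poly_mult
        fps_compose_mult_distrib)
  have "chi_logderiv R (A \<union> B) * (?F * ?G) = (chi_logderiv R A + chi_logderiv R B) * (?F * ?G)"
    using fps_deriv_chi_fps[of R "A \<union> B"] fps_deriv_chi_fps[of R A] fps_deriv_chi_fps[of R B] assms
    by (simp add: mult algebra_simps)
  then show ?thesis using ne by simp
qed

lemma chi_logderiv_empty: "chi_logderiv R {} = 0"
  by (simp add: chi_logderiv_def chi_fps_def chi_empty)

lemma chi_logderiv_image:
  assumes "finite W" "inj_on g W"
    and "\<And>u v. u \<in> W \<Longrightarrow> v \<in> W \<Longrightarrow> (g u, g v) \<in> S \<longleftrightarrow> (u, v) \<in> R"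
  shows "chi_logderiv S (g ` W) = chi_logderiv R W"
  by (simp add: chi_logderiv_def chi_fps_def chi_image[OF assms])

text \<open>Comparing coefficients in \<open>F' = L * F\<close> with \<open>F $ 0 = 1\<close> computes those of \<open>L\<close> recursively.\<close>

lemma chi_logderiv_nth:
  assumes "irrefl R" "finite W"
  shows "chi_logderiv R W $ k = of_nat (Suc k) * ((-1) ^ Suc k * top_coeff R (Suc k) W)
    - (\<Sum>i<k. chi_logderiv R W $ i * ((-1) ^ (k - i) * top_coeff R (k - i) W))"
proof -
  have "of_nat (Suc k) * chi_fps R W $ Suc k = (chi_logderiv R W * chi_fps R W) $ k"
    using fps_deriv_chi_fps[OF assms] by (metis fps_deriv_nth Suc_eq_plus1)
  also have "\<dots> = (\<Sum>i<k. chi_logderiv R W $ i * chi_fps R W $ (k - i)) + chi_logderiv R W $ k"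
    by (simp add: fps_mult_nth atLeast0AtMost flip: lessThan_Suc_atMost)
      (simp add: chi_fps_nth_0 assms)
  finally show ?thesis by (simp add: chi_fps_nth assms)
qed

text \<open>The coefficient of index \<open>k\<close> is homogeneous of weight \<open>k + 1\<close> in the \<open>top_coeff R i\<close>, each of
  weight \<open>i\<close> and degree at most \<open>2 * i\<close>.\<close>

lemma mobius_degree_le_chi_logderiv:
  assumes "irrefl R"
  shows "mobius_degree_le (2 * Suc k) (\<lambda>W. chi_logderiv R W $ k)"
proof (induction k rule: less_induct)
  case (less k)
  let ?g = "\<lambda>W. of_nat (Suc k) * ((-1) ^ Suc k * top_coeff R (Suc k) W)
    - (\<Sum>i<k. chi_logderiv R W $ i * ((-1) ^ (k - i) * top_coeff R (k - i) W))"
  have "mobius_degree_le (2 * Suc k) ?g"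
  proof (intro mobius_degree_le_minus mobius_degree_le_sum)
    show "mobius_degree_le (2 * Suc k)
        (\<lambda>W. of_nat (Suc k) * ((-1) ^ Suc k * top_coeff R (Suc k) W))"
      by (intro mobius_degree_le_cmult mobius_degree_le_top_coeff assms)
    fix i assume i: "i \<in> {..<k}"
    have "mobius_degree_le (2 * Suc i + 2 * (k - i))
        (\<lambda>W. chi_logderiv R W $ i * ((-1) ^ (k - i) * top_coeff R (k - i) W))"
      using i by (intro mobius_degree_le_mult mobius_degree_le_cmult less
          mobius_degree_le_top_coeff assms) auto
    then show "mobius_degree_le (2 * Suc k)
        (\<lambda>W. chi_logderiv R W $ i * ((-1) ^ (k - i) * top_coeff R (k - i) W))"
      by (rule mobius_degree_le_mono) (use i in auto)
  qed
  moreover have "mobius (\<lambda>W. chi_logderiv R W $ k) U = mobius ?g U" if "finite U" for U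
    by (intro mobius_cong chi_logderiv_nth[OF assms]) (use that finite_subset in auto)
  ultimately show ?case by (simp add: mobius_degree_le_def)
qed

text \<open>The contribution of the vertex set \<open>U\<close> alone to the logarithmic derivative, as in the cluster
  expansion of statistical mechanics.\<close>

definition cluster :: "'a rel \<Rightarrow> nat \<Rightarrow> 'a set \<Rightarrow> real" where
  "cluster R k = mobius (\<lambda>W. chi_logderiv R W $ k)"

lemma cluster_large:
  assumes "irrefl R" "finite U" "2 * Suc k < card U"
  shows "cluster R k U = 0"
  using mobius_degree_le_chi_logderiv[OF assms(1), of k] assms
  by (auto simp: cluster_def mobius_degree_le_def)

text \<open>On the subsets of \<open>A \<union> B\<close>, the logarithmic derivative is a sum of a function that ignores \<open>B\<close> and
  one that ignores \<open>A\<close>.\<close>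

lemma cluster_separated:
  assumes "irrefl R" "finite A" "finite B" "separated R A B" "A \<noteq> {}" "B \<noteq> {}"
  shows "cluster R k (A \<union> B) = 0"
proof -
  have fin: "finite (A \<union> B)" using assms by simp
  have AB: "A \<inter> B = {}" using assms by (simp add: separated_def)
  have "cluster R k (A \<union> B)
      = mobius (\<lambda>W. chi_logderiv R (W \<inter> A) $ k + chi_logderiv R (W \<inter> B) $ k) (A \<union> B)"
    unfolding cluster_def
  proof (rule mobius_cong)
    fix T assume T: "T \<subseteq> A \<union> B"
    then have "T = (T \<inter> A) \<union> (T \<inter> B)" by auto
    moreover have "separated R (T \<inter> A) (T \<inter> B)" using assms(4) by (auto simp: separated_def)
    ultimately have "chi_logderiv R T = chi_logderiv R (T \<inter> A) + chi_logderiv R (T \<inter> B)"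
      using chi_logderiv_separated[OF assms(1), of "T \<inter> A" "T \<inter> B"] assms(2,3) by simp
    then show "chi_logderiv R T $ k = chi_logderiv R (T \<inter> A) $ k + chi_logderiv R (T \<inter> B) $ k"
      by simp
  qed
  also have "\<dots> = mobius (\<lambda>W. chi_logderiv R (W \<inter> A) $ k) (A \<union> B)
      + mobius (\<lambda>W. chi_logderiv R (W \<inter> B) $ k) (A \<union> B)"
    by (rule mobius_add)
  also have "mobius (\<lambda>W. chi_logderiv R (W \<inter> A) $ k) (A \<union> B) = 0"
  proof -
    obtain v where "v \<in> B" using assms by auto
    moreover from this AB have "v \<notin> A" by auto
    ultimately show ?thesis by (intro mobius_eq_0I[OF fin, of v]) auto
  qed
  also have "mobius (\<lambda>W. chi_logderiv R (W \<inter> B) $ k) (A \<union> B) = 0"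
  proof -
    obtain v where "v \<in> A" using assms by auto
    moreover from this AB have "v \<notin> B" by auto
    ultimately show ?thesis by (intro mobius_eq_0I[OF fin, of v]) auto
  qed
  finally show ?thesis by simp
qed

lemma cluster_image:
  assumes "finite U" "inj_on g U"
    and "\<And>u v. u \<in> U \<Longrightarrow> v \<in> U \<Longrightarrow> (g u, g v) \<in> S \<longleftrightarrow> (u, v) \<in> R"
  shows "cluster S k (g ` U) = cluster R k U"
proof -
  have "cluster S k (g ` U) = mobius (\<lambda>T. chi_logderiv S (g ` T) $ k) U"
    unfolding cluster_def by (rule mobius_image[OF assms(2)])
  also have "\<dots> = cluster R k U"
    unfolding cluster_def
  proof (rule mobius_cong)
    fix T assume T: "T \<subseteq> U"
    have "chi_logderiv S (g ` T) = chi_logderiv R T"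
      by (rule chi_logderiv_image) (use T assms in \<open>auto intro: finite_subset inj_on_subset\<close>)
    then show "chi_logderiv S (g ` T) $ k = chi_logderiv R T $ k" by simp
  qed
  finally show ?thesis .
qed

lemma chi_logderiv_nth_eq_sum_cluster:
  "finite V \<Longrightarrow> chi_logderiv R V $ k = (\<Sum>U\<in>Pow V. cluster R k U)"
  by (simp add: cluster_def sum_mobius)

section \<open>Clusters are local\<close>

text \<open>The ball of radius \<open>j\<close> around \<open>z\<close> in the graph distance.\<close>

primrec nbhd :: "'a rel \<Rightarrow> 'a \<Rightarrow> nat \<Rightarrow> 'a set" where
  "nbhd R z 0 = {z}"
| "nbhd R z (Suc j) = nbhd R z j \<union> R `` nbhd R z j"

lemma nbhd_mono: "i \<le> j \<Longrightarrow> nbhd R z i \<subseteq> nbhd R z j"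
  by (induction j rule: nat_induct) (auto simp: le_Suc_eq)

lemma self_in_nbhd: "z \<in> nbhd R z j"
  using nbhd_mono[of 0 j R z] by auto

text \<open>A set with a nonzero cluster is connected and has at most \<open>2 * Suc k\<close> vertices. Connectedness
  means that each ball around \<open>v\<close> that does not yet contain \<open>U\<close> meets \<open>U\<close> in fewer vertices than the
  next ball does, so \<open>U\<close> is exhausted after \<open>card U\<close> steps.\<close>

lemma cluster_local:
  assumes "irrefl R" "sym R" "finite U" "v \<in> U" "cluster R k U \<noteq> 0"
  shows "U \<subseteq> nbhd R v (2 * Suc k)"
proof -
  have grow: "U \<subseteq> nbhd R v j \<or> j < card (U \<inter> nbhd R v j)" for j
  proof (induction j)
    case 0
    have "U \<inter> nbhd R v 0 = {v}" using assms(4) by auto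
    then show ?case by simp
  next
    case (Suc j)
    let ?A = "U \<inter> nbhd R v j" and ?B = "U - nbhd R v j"
    show ?case
    proof (cases "?B = {}")
      case True
      then show ?thesis by auto
    next
      case False
      have "?A \<noteq> {}" using assms(4) self_in_nbhd[of v R j] by auto
      moreover have "?A \<union> ?B = U" by auto
      ultimately have "\<not> separated R ?A ?B"
        using cluster_separated[OF assms(1), of ?A ?B k] assms(3,5) False by auto
      then obtain a b where "a \<in> ?A" "b \<in> ?B" "(a, b) \<in> R"
        using assms(2) by (auto simp: separated_def dest: symD)
      then have "insert b ?A \<subseteq> U \<inter> nbhd R v (Suc j)" "b \<notin> ?A" by auto
      moreover from this have "card (insert b ?A) \<le> card (U \<inter> nbhd R v (Suc j))"
        using assms(3) by (intro card_mono) auto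
      moreover have "j < card ?A" using Suc False by auto
      ultimately show ?thesis using assms(3) by simp
    qed
  qed
  have "card (U \<inter> nbhd R v (2 * Suc k)) \<le> card U"
    using assms(3) by (intro card_mono) auto
  moreover have "card U \<le> 2 * Suc k"
    using cluster_large[OF assms(1,3)] assms(5) by (meson not_less)
  ultimately show ?thesis using grow[of "2 * Suc k"] by linarith
qed

text \<open>Edges map to edges and lift along \<open>g\<close> from any preimage of their starting point, so balls are
  mapped onto balls. Uniqueness of lifts will come from injectivity of \<open>g\<close> on a ball.\<close>

definition covering :: "'a rel \<Rightarrow> 'b rel \<Rightarrow> ('a \<Rightarrow> 'b) \<Rightarrow> bool" where
  "covering R S g \<longleftrightarrow> (\<forall>u w. (u, w) \<in> R \<longrightarrow> (g u, g w) \<in> S) \<and>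
    (\<forall>u q. (g u, q) \<in> S \<longrightarrow> (\<exists>w. (u, w) \<in> R \<and> g w = q))"

lemma nbhd_covering:
  assumes "covering R S g"
  shows "nbhd S (g z) j = g ` nbhd R z j"
proof (induction j)
  case (Suc j)
  have "S `` (g ` A) = g ` (R `` A)" for A
    using assms unfolding covering_def by blast
  then show ?case by (simp add: Suc image_Un)
qed simp

text \<open>The share of the vertex \<open>z\<close>, where each cluster is divided equally among its vertices. In a simple
  graph the ball contains every set through \<open>z\<close> with a nonzero cluster, by \<open>cluster_local\<close>.\<close>

definition cluster_density :: "'a rel \<Rightarrow> nat \<Rightarrow> 'a \<Rightarrow> real" where
  "cluster_density R k z =
    (\<Sum>U | U \<subseteq> nbhd R z (2 * Suc k) \<and> z \<in> U. cluster R k U / card U)"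

text \<open>The clusters through \<open>g z\<close> live in the ball of radius \<open>2 * Suc k\<close> around it, which \<open>g\<close> identifies
  with the ball around \<open>z\<close>. Injectivity on a ball of radius one larger makes this an isomorphism of
  induced subgraphs: the lift of an edge that ends in the image of the smaller ball starts in the
  smaller ball but might end outside it.\<close>

lemma sum_cluster_at_covering:
  assumes "irrefl S" "sym S" "finite V" "range g \<subseteq> V"
    and cov: "covering R S g"
    and fin: "finite (nbhd R z (2 * Suc k))"
    and inj: "inj_on g (nbhd R z (Suc (2 * Suc k)))"
  shows "(\<Sum>U | U \<subseteq> V \<and> g z \<in> U. cluster S k U / card U) = cluster_density R k z"
proof -
  define r where "r = 2 * Suc k"
  note fin = fin[folded r_def] and inj = inj[folded r_def]
  let ?N = "nbhd R z r"
  have inj': "inj_on g ?N"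
    using inj nbhd_mono[of r "Suc r" R z] by (auto intro: inj_on_subset)
  have iso: "(g u, g w) \<in> S \<longleftrightarrow> (u, w) \<in> R" if "u \<in> ?N" "w \<in> ?N" for u w
  proof
    assume "(g u, g w) \<in> S"
    then obtain w' where w': "(u, w') \<in> R" "g w' = g w"
      using cov unfolding covering_def by blast
    (* The lift of the edge need not end at w, but both ends lie where g is injective. *)
    have "w' \<in> nbhd R z (Suc r)" "w \<in> nbhd R z (Suc r)"
      unfolding nbhd.simps(2)[of R z r] using that w'(1) by blast+
    then have "w' = w" by (rule inj_onD[OF inj w'(2)])
    with w' show "(u, w) \<in> R" by simp
  next
    assume "(u, w) \<in> R"
    then show "(g u, g w) \<in> S" using cov unfolding covering_def by blast
  qed
  have "(\<Sum>U | U \<subseteq> V \<and> g z \<in> U. cluster S k U / card U)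
      = (\<Sum>U | U \<subseteq> g ` ?N \<and> g z \<in> U. cluster S k U / card U)"
  proof (rule sum.mono_neutral_right)
    show "finite {U. U \<subseteq> V \<and> g z \<in> U}" using assms(3) by simp
    show "{U. U \<subseteq> g ` ?N \<and> g z \<in> U} \<subseteq> {U. U \<subseteq> V \<and> g z \<in> U}" using assms(4) by blast
    show "\<forall>U\<in>{U. U \<subseteq> V \<and> g z \<in> U} - {U. U \<subseteq> g ` ?N \<and> g z \<in> U}. cluster S k U / card U = 0"
    proof
      fix U assume U: "U \<in> {U. U \<subseteq> V \<and> g z \<in> U} - {U. U \<subseteq> g ` ?N \<and> g z \<in> U}"
      then have "\<not> U \<subseteq> nbhd S (g z) (2 * Suc k)" "finite U" "g z \<in> U"
        using finite_subset[OF _ assms(3)] by (auto simp only: nbhd_covering[OF cov] r_def)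
      then have "cluster S k U = 0" using cluster_local[OF assms(1,2)] by blast
      then show "cluster S k U / card U = 0" by simp
    qed
  qed
  also have "\<dots> = cluster_density R k z"
    unfolding cluster_density_def r_def[symmetric]
  proof (rule sum.reindex_cong[of "image g"])
    have z: "z \<in> ?N" by (rule self_in_nbhd)
    show "inj_on (image g) {U. U \<subseteq> ?N \<and> z \<in> U}"
      using inj_on_image_Pow[OF inj'] by (rule inj_on_subset) auto
    show "{U. U \<subseteq> g ` ?N \<and> g z \<in> U} = image g ` {U. U \<subseteq> ?N \<and> z \<in> U}"
    proof (intro equalityI subsetI)
      fix U assume "U \<in> {U. U \<subseteq> g ` ?N \<and> g z \<in> U}"
      then obtain X where X: "X \<subseteq> ?N" "U = g ` X" "g z \<in> g ` X"
        by (auto simp: subset_image_iff)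
      then have "z \<in> X" using inj_on_image_mem_iff[OF inj' z X(1)] by simp
      with X show "U \<in> image g ` {U. U \<subseteq> ?N \<and> z \<in> U}" by auto
    qed auto
    fix U assume U: "U \<in> {U. U \<subseteq> ?N \<and> z \<in> U}"
    then have injU: "inj_on g U" and finU: "finite U"
      using inj' fin by (auto intro: inj_on_subset finite_subset)
    have "cluster S k (g ` U) = cluster R k U"
      using U iso by (intro cluster_image[OF finU injU]) auto
    then show "cluster S k (g ` U) / card (g ` U) = cluster R k U / card U"
      by (simp add: card_image[OF injU])
  qed
  finally show ?thesis .
qed

lemma chi_logderiv_nth_eq_sum_vertices:
  assumes "finite V"
  shows "chi_logderiv R V $ k = (\<Sum>v\<in>V. \<Sum>U | U \<subseteq> V \<and> v \<in> U. cluster R k U / card U)"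
proof -
  have "cluster R k U = (\<Sum>v | v \<in> V \<and> v \<in> U. cluster R k U / card U)" if "U \<in> Pow V" for U
  proof -
    have "finite U" "{v. v \<in> V \<and> v \<in> U} = U" using that assms by (auto intro: finite_subset)
    moreover have "cluster R k {} = 0"
      by (simp add: cluster_def mobius_def chi_logderiv_empty)
    ultimately show ?thesis by (cases "U = {}") auto
  qed
  then have "chi_logderiv R V $ k = (\<Sum>U\<in>Pow V. \<Sum>v | v \<in> V \<and> v \<in> U. cluster R k U / card U)"
    unfolding chi_logderiv_nth_eq_sum_cluster[OF assms] by (intro sum.cong) auto
  also have "\<dots> = (\<Sum>v\<in>V. \<Sum>U | U \<in> Pow V \<and> v \<in> U. cluster R k U / card U)"
    using assms by (intro sum.swap_restrict) auto
  finally show ?thesis by simp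
qed

text \<open>If \<open>S\<close> looks the same around each vertex, namely like \<open>R\<close> around \<open>z\<close>, then the logarithmic
  derivative is proportional to the number of vertices.\<close>

lemma chi_logderiv_nth_covering:
  assumes "irrefl S" "sym S" "finite V" "finite (nbhd R z (2 * Suc k))"
    and "\<And>v. v \<in> V \<Longrightarrow> \<exists>g. covering R S g \<and> range g \<subseteq> V \<and> g z = v \<and>
      inj_on g (nbhd R z (Suc (2 * Suc k)))"
  shows "chi_logderiv S V $ k = card V * cluster_density R k z"
proof -
  have "(\<Sum>U | U \<subseteq> V \<and> v \<in> U. cluster S k U / card U) = cluster_density R k z" if "v \<in> V" for v
  proof -
    obtain g where g: "covering R S g" "range g \<subseteq> V" "g z = v"
      "inj_on g (nbhd R z (Suc (2 * Suc k)))"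
      using assms(5)[OF \<open>v \<in> V\<close>] by (elim exE conjE)
    show ?thesis
      using sum_cluster_at_covering[OF assms(1-3) g(2,1) assms(4) g(4)] by (simp only: g(3))
  qed
  then show ?thesis by (simp add: chi_logderiv_nth_eq_sum_vertices assms(3))
qed

section \<open>The toroidal grid\<close>

definition int_grid :: "(int \<times> int) rel" where
  "int_grid = {((x, y), (x', y')). \<bar>x - x'\<bar> + \<bar>y - y'\<bar> = 1}"

lemma nbhd_int_grid: "nbhd int_grid (0, 0) j \<subseteq> {- int j..int j} \<times> {- int j..int j}"
proof (induction j)
  case (Suc j)
  then show ?case by (force simp: int_grid_def)
qed simp

definition wrap :: "nat \<Rightarrow> int \<Rightarrow> nat" where
  "wrap n x = nat (x mod int n)"

lemma wrap_less: "n > 0 \<Longrightarrow> wrap n x < n"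
  by (simp add: wrap_def nat_less_iff)

lemma int_wrap: "n > 0 \<Longrightarrow> int (wrap n x) = x mod int n"
  by (simp add: wrap_def)

lemma wrap_int: "i < n \<Longrightarrow> wrap n (int i) = i"
  by (simp add: wrap_def)

lemma pverts_cycle_graph: "pverts (cycle_graph n) = {..<n}"
  by (simp add: cycle_graph_def)

lemma cycle_graph_wrap_iff:
  assumes "n > 0"
  shows "(wrap n x, j) \<in> parcs (cycle_graph n) \<longleftrightarrow> j = wrap n (x + 1) \<or> j = wrap n (x - 1)"
proof -
  have plus: "(wrap n y + 1) mod n = wrap n (y + 1)" for y
  proof -
    have "int ((wrap n y + 1) mod n) = int (wrap n (y + 1))"
      using assms by (simp add: zmod_int int_wrap mod_add_right_eq add.commute)
    then show ?thesis by simp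
  qed
  have minus: "j = wrap n (x - 1)" if "j < n" "wrap n x = (j + 1) mod n"
  proof -
    have "int (wrap n x) = (int j + 1) mod int n" using that(2) by (simp add: zmod_int add.commute)
    then have "x mod int n = (int j + 1) mod int n" using assms by (simp add: int_wrap)
    then have "(x - 1) mod int n = (int j + 1 - 1) mod int n" by (metis mod_diff_left_eq)
    then show ?thesis using that(1) by (simp add: wrap_def)
  qed
  show ?thesis
    using minus plus[of x] plus[of "x - 1"] wrap_less[OF assms]
    by (auto simp: cycle_graph_def)
qed

lemma wrap_inj:
  assumes "wrap n x = wrap n y" "n > 0" "\<bar>x - y\<bar> < int n"
  shows "x = y"
proof -
  have "int n dvd x - y" using assms by (metis int_wrap mod_eq_dvd_iff)
  then have "\<not> 0 < \<bar>x - y\<bar>" using zdvd_not_zless[OF _ assms(3)] by auto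
  then show ?thesis by simp
qed

text \<open>The integer grid is the universal cover of the torus; the shift by \<open>(a, b)\<close> moves the image of the
  origin to a given vertex.\<close>

lemma covering_torus:
  assumes "n > 0"
  shows "covering int_grid (parcs (toroidal_grid n)) (\<lambda>(x, y). (wrap n (a + x), wrap n (b + y)))"
proof -
  let ?g = "\<lambda>(x, y). (wrap n (a + x), wrap n (b + y))"
  have adj: "((wrap n (a + x), wrap n (b + y)), q) \<in> parcs (toroidal_grid n) \<longleftrightarrow>
      q \<in> {?g (x + 1, y), ?g (x - 1, y), ?g (x, y + 1), ?g (x, y - 1)}" for x y q
    using wrap_less[OF assms]
    by (cases q) (auto simp: toroidal_grid_def product_graph_def cycle_graph_wrap_iff[OF assms]
        add.assoc add_diff_eq pverts_cycle_graph)
  have nb: "((x, y), w) \<in> int_grid \<longleftrightarrow>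
      w \<in> {(x + 1, y), (x - 1, y), (x, y + 1), (x, y - 1)}" for x y w
    by (cases w) (auto simp: int_grid_def abs_if split: if_splits)
  show ?thesis
    unfolding covering_def
  proof (intro conjI allI impI)
    fix u w assume "(u, w) \<in> int_grid"
    then show "(?g u, ?g w) \<in> parcs (toroidal_grid n)"
      by (cases u) (auto simp: nb adj)
  next
    fix u q assume "(?g u, q) \<in> parcs (toroidal_grid n)"
    then show "\<exists>w. (u, w) \<in> int_grid \<and> ?g w = q"
      by (cases u) (auto simp: nb adj)
  qed
qed

lemma
  assumes "n \<ge> 3"
  shows irrefl_torus: "irrefl (parcs (toroidal_grid n))"
    and sym_torus: "sym (parcs (toroidal_grid n))"
    and finite_torus: "finite (pverts (toroidal_grid n))"
    and arcs_torus:
      "parcs (toroidal_grid n) \<subseteq> pverts (toroidal_grid n) \<times> pverts (toroidal_grid n)"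
proof -
  interpret pair_graph "toroidal_grid n" by (rule pair_graph_toroidal_grid[OF assms])
  show "irrefl (parcs (toroidal_grid n))" using pair_no_loops by (force simp: irrefl_def)
  show "sym (parcs (toroidal_grid n))" using sym_arcs by (simp add: symmetric_def)
  show "finite (pverts (toroidal_grid n))" by (rule pair_finite_verts)
  show "parcs (toroidal_grid n) \<subseteq> pverts (toroidal_grid n) \<times> pverts (toroidal_grid n)"
    by (auto dest: wellformed')
qed

text \<open>The map from the grid has to be injective on a ball of radius \<open>2 * k + 3\<close>, in which coordinates
  differ by at most \<open>4 * k + 6\<close>.\<close>

lemma chi_logderiv_torus:
  assumes "n \<ge> 4 * k + 7"
  shows "chi_logderiv (parcs (toroidal_grid n)) (pverts (toroidal_grid n)) $ k
    = real (n\<^sup>2) * cluster_density int_grid k (0, 0)"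
proof -
  let ?S = "parcs (toroidal_grid n)" and ?V = "pverts (toroidal_grid n)"
  have V: "?V = {..<n} \<times> {..<n}"
    by (simp add: toroidal_grid_def product_graph_def cycle_graph_def)
  have n: "n \<ge> 3" "n > 0" using assms by auto
  have "chi_logderiv ?S ?V $ k = card ?V * cluster_density int_grid k (0, 0)"
  proof (rule chi_logderiv_nth_covering)
    show "irrefl ?S" "sym ?S" "finite ?V"
      by (fact irrefl_torus[OF n(1)] sym_torus[OF n(1)] finite_torus[OF n(1)])+
    show "finite (nbhd int_grid (0, 0) (2 * Suc k))"
      by (rule finite_subset[OF nbhd_int_grid]) simp
    fix v assume "v \<in> ?V"
    then obtain a b where v: "v = (a, b)" "a < n" "b < n" by (auto simp: V)
    let ?g = "\<lambda>(x, y). (wrap n (int a + x), wrap n (int b + y))"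
    have "inj_on ?g (nbhd int_grid (0, 0) (Suc (2 * Suc k)))"
    proof (rule inj_onI)
      fix p q
      assume p: "p \<in> nbhd int_grid (0, 0) (Suc (2 * Suc k))"
        and q: "q \<in> nbhd int_grid (0, 0) (Suc (2 * Suc k))" and eq: "?g p = ?g q"
      obtain x y x' y' where xy: "p = (x, y)" "q = (x', y')" by fastforce
      have "\<bar>(int a + x) - (int a + x')\<bar> < int n" "\<bar>(int b + y) - (int b + y')\<bar> < int n"
        using subsetD[OF nbhd_int_grid p] subsetD[OF nbhd_int_grid q] assms xy by auto
      moreover have "wrap n (int a + x) = wrap n (int a + x')"
        "wrap n (int b + y) = wrap n (int b + y')"
        using eq xy by auto
      ultimately have "int a + x = int a + x'" "int b + y = int b + y'"
        using wrap_inj[OF _ n(2)] by blast+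
      then show "p = q" using xy by simp
    qed
    moreover have "range ?g \<subseteq> ?V" using wrap_less[OF n(2)] by (auto simp: V)
    moreover have "?g (0, 0) = v" using v by (simp add: wrap_int)
    ultimately show "\<exists>g. covering int_grid ?S g \<and> range g \<subseteq> ?V \<and> g (0, 0) = v \<and>
        inj_on g (nbhd int_grid (0, 0) (Suc (2 * Suc k)))"
      by (intro exI[of _ ?g] conjI covering_torus[OF n(2)])
  qed
  also have "card ?V = n\<^sup>2" by (simp add: V power2_eq_square)
  finally show ?thesis .
qed

lemma toroidal_coeff_eq_chi_fps:
  assumes "n \<ge> 3"
  shows "(-1) ^ k * of_int (toroidal_coeff k n)
    = chi_fps (parcs (toroidal_grid n)) (pverts (toroidal_grid n)) $ k"
proof -
  let ?S = "parcs (toroidal_grid n)" and ?V = "pverts (toroidal_grid n)"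
  have "?S \<inter> ?V \<times> ?V = ?S" using arcs_torus[OF assms] by auto
  then have "graph_on ?S ?V = toroidal_grid n" by (simp add: graph_on_def)
  moreover have "card ?V = n\<^sup>2"
    by (simp add: toroidal_grid_def product_graph_def cycle_graph_def power2_eq_square)
  ultimately show ?thesis
    by (simp add: chi_fps_nth irrefl_torus finite_torus assms top_coeff_def toroidal_coeff_def chi_def
        coeff_map_poly)
qed

section \<open>Exponentials and sequences of binomial type\<close>

text \<open>The powers of \<open>exp G\<close> are \<open>exp (m * G)\<close>.\<close>

lemma binomial_type_exp:
  fixes G :: "real fps"
  assumes "G $ 0 = 0" "\<And>k x. poly (P k) x = (fps_exp x oo G) $ k"
  shows "binomial_type P"
  unfolding binomial_type_def
proof (intro conjI allI impI)
  show "P 0 = 1"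
    by (rule real_poly_eq_if_eq_on_nats) (simp add: assms)
  show "poly (P i) 0 = 0" if "i > 0" for i
    using that by (simp add: assms)
  have E: "Abs_fps (\<lambda>i. poly (P i) x) = fps_exp x oo G" for x
    by (simp add: fps_eq_iff assms)
  show "Abs_fps (\<lambda>i. poly (P i) 1) ^ m = Abs_fps (\<lambda>i. poly (P i) (of_nat m))" for m
    by (simp add: E fps_compose_power[OF assms(1)] fps_exp_power_mult)
qed

lemma poly_fps_exp_compose:
  fixes G :: "real fps"
  shows "poly (\<Sum>i\<le>k. monom ((G ^ i) $ k / fact i) i) x = (fps_exp x oo G) $ k"
  by (simp add: poly_sum poly_monom fps_compose_nth atLeast0AtMost mult_ac)

text \<open>The equation \<open>F' = L * F\<close> determines \<open>F\<close> up to degree \<open>k\<close> from \<open>L\<close> up to degree \<open>k - 1\<close>. On a finite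
  torus only finitely many coefficients of \<open>L\<close> have the form \<open>x * c j\<close>, so the statement is about a
  single coefficient.\<close>

lemma fps_nth_eq_exp_if_logderiv:
  fixes F L :: "real fps"
  assumes "F $ 0 = 1" "fps_deriv F = L * F" "\<And>j. j < k \<Longrightarrow> L $ j = x * c j"
  shows "F $ k = (fps_exp x oo fps_integral0 (Abs_fps c)) $ k"
proof -
  let ?E = "fps_exp x oo fps_integral0 (Abs_fps c)"
  have E: "fps_deriv ?E = (fps_const x * Abs_fps c) * ?E"
    by (simp add: fps_compose_deriv fps_deriv_fps_integral fps_const_mult_apply_left mult_ac)
  have "F $ j = ?E $ j" if "j \<le> k" for j
    using that
  proof (induction j rule: less_induct)
    case (less j)
    show ?case
    proof (cases j)
      case 0
      then show ?thesis by (simp add: assms)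
    next
      case (Suc m)
      have "of_nat (Suc m) * F $ Suc m = (L * F) $ m"
        using assms(2) by (metis fps_deriv_nth Suc_eq_plus1)
      also have "\<dots> = ((fps_const x * Abs_fps c) * ?E) $ m"
      proof -
        have "(fps_const x * Abs_fps c) $ i = x * c i" for i by simp
        then show ?thesis
          unfolding fps_mult_nth[of L] fps_mult_nth[of _ ?E]
          using Suc less by (intro sum.cong) (auto simp: assms(3))
      qed
      also have "\<dots> = of_nat (Suc m) * ?E $ Suc m"
        using E by (metis fps_deriv_nth Suc_eq_plus1)
      finally show ?thesis by (simp add: Suc del: of_nat_Suc)
    qed
  qed
  then show ?thesis by simp
qed

theorem theorem6p1:
  shows "\<exists>(P :: nat \<Rightarrow> real poly) (N :: nat \<Rightarrow> nat).
    (\<forall>k n. n \<ge> 3 \<and> n \<ge> N k \<longrightarrow>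
       (-1) ^ k * of_int (toroidal_coeff k n) = poly (P k) (of_nat (n\<^sup>2))) \<and>
    binomial_type P"
proof -
  define c where "c k = cluster_density int_grid k (0, 0)" for k
  define G where "G = fps_integral0 (Abs_fps c)"
  define P where "P k = (\<Sum>i\<le>k. monom ((G ^ i) $ k / fact i) i)" for k
  have P: "poly (P k) x = (fps_exp x oo G) $ k" for k x
    unfolding P_def by (rule poly_fps_exp_compose)
  have "(-1) ^ k * of_int (toroidal_coeff k n) = poly (P k) (of_nat (n\<^sup>2))"
    if n: "n \<ge> 3" "n \<ge> 4 * k + 7" for k n
  proof -
    let ?S = "parcs (toroidal_grid n)" and ?V = "pverts (toroidal_grid n)"
    note irrefl = irrefl_torus[OF n(1)] and fin = finite_torus[OF n(1)]
    have "chi_fps ?S ?V $ k = (fps_exp (real (n\<^sup>2)) oo fps_integral0 (Abs_fps c)) $ k"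
    proof (rule fps_nth_eq_exp_if_logderiv)
      show "chi_fps ?S ?V $ 0 = 1"
        by (rule chi_fps_nth_0[OF irrefl fin])
      show "fps_deriv (chi_fps ?S ?V) = chi_logderiv ?S ?V * chi_fps ?S ?V"
        by (rule fps_deriv_chi_fps[OF irrefl fin])
      show "chi_logderiv ?S ?V $ j = real (n\<^sup>2) * c j" if "j < k" for j
        unfolding c_def using that n by (intro chi_logderiv_torus) auto
    qed
    then show ?thesis
      by (simp only: P G_def toroidal_coeff_eq_chi_fps[OF n(1)])
  qed
  moreover have "binomial_type P"
  proof (rule binomial_type_exp)
    show "G $ 0 = 0" by (simp add: G_def)
    show "poly (P k) x = (fps_exp x oo G) $ k" for k x by (rule P)
  qed
  ultimately have "(\<forall>k n. n \<ge> 3 \<and> n \<ge> 4 * k + 7 \<longrightarrow>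
      (-1) ^ k * of_int (toroidal_coeff k n) = poly (P k) (of_nat (n\<^sup>2))) \<and> binomial_type P"
    by auto
  then show ?thesis by (rule exI[of _ P, OF exI[of _ "\<lambda>k. 4 * k + 7"]])
qed

end
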